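(* For $n=2$, each of the $16$ preference profiles for $2$ men and $2$ women is of exactly one of the types A, B, C, D, and: (A) there are $4$ profiles of type A; each is disjoint and has exactly $1$ stable matching, whose total egalitarian cost is $6$; (B) there are $8$ profiles of type B; each is disjoint and has exactly $1$ stable matching, whose total egalitarian cost is $5$; (C) there are $2$ profiles of type C; each is a joint profile, and in fact a mirror profile, and has exactly $1$ stable matching, whose total egalitarian cost is $4$; (D) there are $2$ profiles of type D; each is a joint profile, and in fact a pseudo-Latin profile, and has exactly $2$ stable matchings, each with total egalitarian cost $6$.
   Context: A preference profile for $n$ men and $n$ women consists of a strict ranking (without ties) by each man of all $n$ women and by each woman of all $n$ men, with ranks $1,\dots,n$, where $1$ is the most preferred. For woman $w$ and man $m$, their mutual ranking is the pair $(s,t)$, where $s$ is the rank that $w$ gives to $m$ and $t$ is the rank that $m$ gives to $w$; the egalitarian cost of the pair is $s+t$. A matching is a perfect matching of men with women; it is stable if there is no man and woman, not matched to each other, who each prefer the other to their assigned partner. The (total) egalitarian cost of a matching is the sum of the egalitarian costs of its couples. A profile is disjoint if each pair $(i,j)$, $1\le i,j\le n$, occurs as the mutual ranking of exactly one man-woman pair. A profile is joint if there is a function $f$ such that whenever a woman ranks a man as $i$, he ranks her as $f(i)$. A joint profile is a mirror profile if $f(i)=i$ for all $i$. A profile is pseudo-Latin if every man-woman pair has egalitarian cost $n+1$. Types for $n=2$ (each up to relabeling the men, relabeling the women, and interchanging the roles of men and women): Type A: both men prefer the first woman, and both women prefer the first man. Type B: both men prefer the first woman; the first woman prefers the first man,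 and the second woman prefers the second man. Type C: the first man prefers the first woman, the second man prefers the second woman, the first woman prefers the first man, and the second woman prefers the second man. Type D: the first man prefers the first woman, the second man prefers the second woman, the first woman prefers the second man, and the second woman prefers the first man. *)

theory Defs
  imports Main "HOL-Library.FuncSet" "HOL-Combinatorics.Permutations"
begin

text \<open>
  Men and women are both numbered by \<open>{1..n}\<close>. The value \<open>man_rank p m w\<close> is the rank that man
  \<open>m\<close> gives to woman \<open>w\<close>, and \<open>woman_rank p w m\<close> the rank that woman \<open>w\<close> gives to man \<open>m\<close>;
  rank 1 is the most preferred.
\<close>

record profile =
  man_rank :: "nat \<Rightarrow> nat \<Rightarrow> nat"
  woman_rank :: "nat \<Rightarrow> nat \<Rightarrow> nat"

text \<open>Everything is extensional outside \<open>{1..n}\<close>, so that cardinalities count actual profiles.\<close>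

definition rankings :: "nat \<Rightarrow> (nat \<Rightarrow> nat) set" where
  "rankings n = {r \<in> {1..n} \<rightarrow>\<^sub>E {1..n}. bij_betw r {1..n} {1..n}}"

definition profiles :: "nat \<Rightarrow> profile set" where
  "profiles n = {p. man_rank p \<in> {1..n} \<rightarrow>\<^sub>E rankings n \<and> woman_rank p \<in> {1..n} \<rightarrow>\<^sub>E rankings n}"

definition man_prefers :: "profile \<Rightarrow> nat \<Rightarrow> nat \<Rightarrow> nat \<Rightarrow> bool" where
  "man_prefers p m w w' \<longleftrightarrow> man_rank p m w < man_rank p m w'"

definition woman_prefers :: "profile \<Rightarrow> nat \<Rightarrow> nat \<Rightarrow> nat \<Rightarrow> bool" where
  "woman_prefers p w m m' \<longleftrightarrow> woman_rank p w m < woman_rank p w m'"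

definition mutual_ranking :: "profile \<Rightarrow> nat \<Rightarrow> nat \<Rightarrow> nat \<times> nat" where
  "mutual_ranking p w m = (woman_rank p w m, man_rank p m w)"

definition egalitarian_cost :: "profile \<Rightarrow> nat \<Rightarrow> nat \<Rightarrow> nat" where
  "egalitarian_cost p w m = fst (mutual_ranking p w m) + snd (mutual_ranking p w m)"


text \<open>A matching is the set of its couples (man, woman).\<close>

definition perfect_matching :: "nat \<Rightarrow> (nat \<times> nat) set \<Rightarrow> bool" where
  "perfect_matching n \<mu> \<longleftrightarrow>
     \<mu> \<subseteq> {1..n} \<times> {1..n} \<and>
     (\<forall>m\<in>{1..n}. \<exists>!w. (m, w) \<in> \<mu>) \<and>
     (\<forall>w\<in>{1..n}. \<exists>!m. (m, w) \<in> \<mu>)"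

definition blocking_pair :: "profile \<Rightarrow> (nat \<times> nat) set \<Rightarrow> nat \<Rightarrow> nat \<Rightarrow> bool" where
  "blocking_pair p \<mu> m w \<longleftrightarrow>
     (m, w) \<notin> \<mu> \<and>
     (\<exists>w'. (m, w') \<in> \<mu> \<and> man_prefers p m w w') \<and>
     (\<exists>m'. (m', w) \<in> \<mu> \<and> woman_prefers p w m m')"

definition stable_matchings :: "nat \<Rightarrow> profile \<Rightarrow> (nat \<times> nat) set set" where
  "stable_matchings n p =
     {\<mu>. perfect_matching n \<mu> \<and> \<not> (\<exists>m\<in>{1..n}. \<exists>w\<in>{1..n}. blocking_pair p \<mu> m w)}"

definition total_cost :: "profile \<Rightarrow> (nat \<times> nat) set \<Rightarrow> nat" where
  "total_cost p \<mu> = (\<Sum>(m, w)\<in>\<mu>. egalitarian_cost p w m)"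


definition disjoint_profile :: "nat \<Rightarrow> profile \<Rightarrow> bool" where
  "disjoint_profile n p \<longleftrightarrow>
     (\<forall>i\<in>{1..n}. \<forall>j\<in>{1..n}. \<exists>!(m, w)\<in>{1..n} \<times> {1..n}. mutual_ranking p w m = (i, j))"

definition joint_via :: "nat \<Rightarrow> (nat \<Rightarrow> nat) \<Rightarrow> profile \<Rightarrow> bool" where
  "joint_via n f p \<longleftrightarrow>
     (\<forall>m\<in>{1..n}. \<forall>w\<in>{1..n}. \<forall>i\<in>{1..n}. woman_rank p w m = i \<longrightarrow> man_rank p m w = f i)"

definition joint_profile :: "nat \<Rightarrow> profile \<Rightarrow> bool" where
  "joint_profile n p \<longleftrightarrow> (\<exists>f. joint_via n f p)"

definition mirror_profile :: "nat \<Rightarrow> profile \<Rightarrow> bool" where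
  "mirror_profile n p \<longleftrightarrow> (\<exists>f. joint_via n f p \<and> (\<forall>i\<in>{1..n}. f i = i))"

definition pseudo_Latin_profile :: "nat \<Rightarrow> profile \<Rightarrow> bool" where
  "pseudo_Latin_profile n p \<longleftrightarrow> (\<forall>m\<in>{1..n}. \<forall>w\<in>{1..n}. egalitarian_cost p w m = n + 1)"


definition relabel :: "(nat \<Rightarrow> nat) \<Rightarrow> (nat \<Rightarrow> nat) \<Rightarrow> profile \<Rightarrow> profile" where
  "relabel \<sigma> \<tau> p =
     \<lparr>man_rank = (\<lambda>m w. man_rank p (\<sigma> m) (\<tau> w)), woman_rank = (\<lambda>w m. woman_rank p (\<tau> w) (\<sigma> m))\<rparr>"

definition interchange :: "profile \<Rightarrow> profile" where
  "interchange p = \<lparr>man_rank = woman_rank p, woman_rank = man_rank p\<rparr>"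

definition same_up_to_symmetry :: "nat \<Rightarrow> profile \<Rightarrow> profile \<Rightarrow> bool" where
  "same_up_to_symmetry n p q \<longleftrightarrow>
     (\<exists>\<sigma> \<tau>. \<sigma> permutes {1..n} \<and> \<tau> permutes {1..n} \<and>
        (q = relabel \<sigma> \<tau> p \<or> q = relabel \<sigma> \<tau> (interchange p)))"

datatype profile_type = TypeA | TypeB | TypeC | TypeD

fun standard_form :: "profile_type \<Rightarrow> profile \<Rightarrow> bool" where
  "standard_form TypeA p \<longleftrightarrow>
     man_prefers p 1 1 2 \<and> man_prefers p 2 1 2 \<and> woman_prefers p 1 1 2 \<and> woman_prefers p 2 1 2"
| "standard_form TypeB p \<longleftrightarrow>
     man_prefers p 1 1 2 \<and> man_prefers p 2 1 2 \<and> woman_prefers p 1 1 2 \<and> woman_prefers p 2 2 1"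
| "standard_form TypeC p \<longleftrightarrow>
     man_prefers p 1 1 2 \<and> man_prefers p 2 2 1 \<and> woman_prefers p 1 1 2 \<and> woman_prefers p 2 2 1"
| "standard_form TypeD p \<longleftrightarrow>
     man_prefers p 1 1 2 \<and> man_prefers p 2 2 1 \<and> woman_prefers p 1 2 1 \<and> woman_prefers p 2 1 2"

definition of_type :: "profile_type \<Rightarrow> profile \<Rightarrow> bool" where
  "of_type t p \<longleftrightarrow> (\<exists>q. same_up_to_symmetry 2 p q \<and> standard_form t q)"

definition profiles_of_type :: "profile_type \<Rightarrow> profile set" where
  "profiles_of_type t = {p \<in> profiles 2. of_type t p}"

end

theory Submission
  imports Defs
begin

text \<open>
  With two alternatives a strict ranking is determined by which alternative comes first. A profile
  for \<open>n = 2\<close> is therefore four bits: whether man 1, man 2, woman 1 and woman 2 put number 1 of the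
  other side first. That gives 16 profiles.

  The symmetries act on these bits: relabeling the men exchanges the two bits of the men and negates
  both bits of the women, relabeling the women does the same with the roles exchanged, and the
  interchange of men and women swaps the two pairs of bits. Hence the number of sides (men, women)
  whose two members agree on their favorite is invariant. It is 2 for type A, 1 for type B and 0 for
  types C and D; in the last case every person is the favorite of exactly one person, and what remains
  invariant is whether first choices are reciprocated (C) or not (D). Lemma \<open>of_type_iff\<close>
  shows that this invariant is complete: it determines the type, and so the counts
  \<open>4, 8, 2, 2\<close> are counts of bit vectors.

  There are only two perfect matchings, and a pair that blocks one of them belongs to the
  other. Lemma \<open>stable_matchings_of_bits\<close> turns this into a condition on the bits; costs,
  disjointness and jointness are then read off from the bits as well.
\<close>

section \<open>Profiles as four bits\<close>

definition ranking_of_bit :: "bool \<Rightarrow> nat \<Rightarrow> nat" where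
  "ranking_of_bit a = (\<lambda>x\<in>{1..2}. if (x = 1) = a then 1 else 2)"

definition rank_table :: "bool \<Rightarrow> bool \<Rightarrow> nat \<Rightarrow> nat \<Rightarrow> nat" where
  "rank_table a b = (\<lambda>x\<in>{1..2}. ranking_of_bit (if x = 1 then a else b))"

definition profile_of_bits :: "bool \<times> bool \<times> bool \<times> bool \<Rightarrow> profile" where
  "profile_of_bits = (\<lambda>(a, b, c, d). \<lparr>man_rank = rank_table a b, woman_rank = rank_table c d\<rparr>)"

lemma atLeastAtMost_1_2 [simp]: "{1..2} = {1, 2 :: nat}" "{Suc 0..2} = {Suc 0, 2}"
  by auto

lemma ranking_of_bit_simps [simp]:
  "ranking_of_bit a (Suc 0) = (if a then 1 else 2)"
  "ranking_of_bit a 2 = (if a then 2 else 1)"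
  by (simp_all add: ranking_of_bit_def)

lemma ranking_of_bit_extensional: "ranking_of_bit a \<in> extensional {1..2}"
  unfolding ranking_of_bit_def by (rule restrict_extensional)

lemma rank_table_extensional: "rank_table a b \<in> extensional {1..2}"
  unfolding rank_table_def by (rule restrict_extensional)

lemma rank_table_simps [simp]:
  "rank_table a b (Suc 0) = ranking_of_bit a"
  "rank_table a b 2 = ranking_of_bit b"
  by (simp_all add: rank_table_def)

lemma profile_of_bits_simps [simp]:
  "man_rank (profile_of_bits (a, b, c, d)) = rank_table a b"
  "woman_rank (profile_of_bits (a, b, c, d)) = rank_table c d"
  by (simp_all add: profile_of_bits_def)

lemma rankings_2: "rankings 2 = range ranking_of_bit"
proof (intro equalityI subsetI)
  fix r assume "r \<in> rankings 2"
  then have ext: "r \<in> extensional {1..2}" and inj: "inj_on r {1..2}"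
    and vals: "r 1 \<in> {1..2}" "r 2 \<in> {1..2}"
    by (auto simp: rankings_def bij_betw_def PiE_iff)
  from inj have "r 1 \<noteq> r 2"
    by (auto simp: inj_on_def)
  define a where "a \<longleftrightarrow> r 1 = 1"
  have "r x = ranking_of_bit a x" if "x \<in> {1..2}" for x
    using that vals \<open>r 1 \<noteq> r 2\<close> by (auto simp: a_def)
  then have "r = ranking_of_bit a"
    by (rule extensionalityI[OF ext ranking_of_bit_extensional])
  then show "r \<in> range ranking_of_bit" by blast
next
  fix r assume "r \<in> range ranking_of_bit"
  then obtain a where r: "r = ranking_of_bit a" by blast
  have "bij_betw r {1..2} {1..2}"
    unfolding atLeastAtMost_1_2 r by (auto simp: bij_betw_def)
  moreover have "r \<in> extensional {1..2}"
    unfolding r by (rule ranking_of_bit_extensional)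
  ultimately show "r \<in> rankings 2"
    by (auto simp: rankings_def PiE_iff dest: bij_betwE)
qed

lemma rank_tables: "{1..2 :: nat} \<rightarrow>\<^sub>E rankings 2 = {t. \<exists>a b. t = rank_table a b}"
proof (intro equalityI subsetI)
  fix t assume "t \<in> {1..2 :: nat} \<rightarrow>\<^sub>E rankings 2"
  then have ext: "t \<in> extensional {1..2}"
    and "t 1 \<in> range ranking_of_bit" "t 2 \<in> range ranking_of_bit"
    by (auto simp: PiE_iff rankings_2)
  then obtain a b where "t 1 = ranking_of_bit a" "t 2 = ranking_of_bit b" by blast
  then have "t x = rank_table a b x" if "x \<in> {1..2}" for x
    using that by auto
  then have "t = rank_table a b"
    by (rule extensionalityI[OF ext rank_table_extensional])
  then show "t \<in> {t. \<exists>a b. t = rank_table a b}" by blast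
qed (auto simp: rank_table_def rankings_2 PiE_iff)

lemma profiles_2: "profiles 2 = range profile_of_bits"
proof (intro equalityI subsetI)
  fix p assume "p \<in> profiles 2"
  then obtain a b c d where "man_rank p = rank_table a b" "woman_rank p = rank_table c d"
    unfolding profiles_def rank_tables by blast
  then have "p = profile_of_bits (a, b, c, d)" by simp
  then show "p \<in> range profile_of_bits" by blast
next
  fix p assume "p \<in> range profile_of_bits"
  then show "p \<in> profiles 2"
    unfolding profiles_def rank_tables by fastforce
qed

lemma ranking_of_bit_inject [simp]: "ranking_of_bit a = ranking_of_bit b \<longleftrightarrow> a = b"
  by (auto dest: fun_cong[where x = "Suc 0"] split: if_splits)

lemma rank_table_inject [simp]: "rank_table a b = rank_table a' b' \<longleftrightarrow> a = a' \<and> b = b'"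
  by (auto dest: fun_cong[where x = "Suc 0"] fun_cong[where x = 2])

lemma inj_profile_of_bits: "inj profile_of_bits"
  by (auto simp: inj_on_def profile_of_bits_def)

section \<open>The type is determined by agreement and reciprocity\<close>

text \<open>
  The last test separates C from D. There the bits are \<open>(a, \<not> a, c, \<not> c)\<close>, and
  \<open>a = c\<close> says that man 1 and woman 1 both choose each other first or both choose someone
  else; either way each person is the favorite of his or her own favorite.
\<close>

definition type_of_bits :: "bool \<times> bool \<times> bool \<times> bool \<Rightarrow> profile_type" where
  "type_of_bits = (\<lambda>(a, b, c, d).
     if a = b \<and> c = d then TypeA
     else if a = b \<or> c = d then TypeB
     else if a = c then TypeC else TypeD)"

lemma permutes_1_2:
  "\<sigma> permutes {1..2 :: nat} \<longleftrightarrow> \<sigma> = id \<or> \<sigma> = transpose 1 2"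
  unfolding atLeastAtMost_1_2 by (rule permutes_doubleton_iff)

text \<open>
  There are eight symmetries. Each acts on the bits by permuting and negating them, so the
  claim is a propositional statement about four bits.
\<close>

lemma of_type_iff: "of_type t (profile_of_bits x) \<longleftrightarrow> t = type_of_bits x"
proof -
  obtain a b c d where x: "x = (a, b, c, d)" by (cases x)
  have ex: "(\<exists>\<sigma> \<tau>. \<sigma> permutes {1..2 :: nat} \<and> \<tau> permutes {1..2 :: nat} \<and> P \<sigma> \<tau>) \<longleftrightarrow>
      P id id \<or> P id (transpose 1 2) \<or> P (transpose 1 2) id \<or> P (transpose 1 2) (transpose 1 2)"
    for P
    unfolding permutes_1_2 by blast
  have "of_type t (profile_of_bits x) \<longleftrightarrow>
      (\<exists>\<sigma> \<tau>. \<sigma> permutes {1..2} \<and> \<tau> permutes {1..2} \<and>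
        (standard_form t (relabel \<sigma> \<tau> (profile_of_bits x)) \<or>
         standard_form t (relabel \<sigma> \<tau> (interchange (profile_of_bits x)))))"
    unfolding of_type_def same_up_to_symmetry_def by blast
  also have "\<dots> \<longleftrightarrow> t = type_of_bits x"
    unfolding ex x
    by (cases t; cases a; cases b; cases c; cases d)
      (simp_all add: relabel_def interchange_def man_prefers_def woman_prefers_def
        type_of_bits_def)
  finally show ?thesis .
qed

lemma profiles_of_type_eq: "profiles_of_type t = profile_of_bits ` {x. type_of_bits x = t}"
  unfolding profiles_of_type_def profiles_2 by (auto simp: of_type_iff)

lemma card_profile_of_bits: "card (profile_of_bits ` X) = card X"
  by (rule card_image) (rule inj_on_subset[OF inj_profile_of_bits subset_UNIV])

lemma card_Collect_bits:
  "card {x. P x} = (\<Sum>a\<in>UNIV. \<Sum>b\<in>UNIV. \<Sum>c\<in>UNIV. \<Sum>d\<in>UNIV. of_bool (P (a, b, c, d)))"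
  for P :: "bool \<times> bool \<times> bool \<times> bool \<Rightarrow> bool"
proof -
  have "card {x. P x} = (\<Sum>x\<in>UNIV. of_bool (P x))"
    by simp
  then show ?thesis
    by (simp add: sum.cartesian_product' flip: UNIV_Times_UNIV)
qed

lemma card_profiles_of_type:
  "card (profiles_of_type TypeA) = 4" "card (profiles_of_type TypeB) = 8"
  "card (profiles_of_type TypeC) = 2" "card (profiles_of_type TypeD) = 2"
  unfolding profiles_of_type_eq card_profile_of_bits card_Collect_bits
  by (simp_all add: UNIV_bool type_of_bits_def)

section \<open>Stable matchings for two couples\<close>

abbreviation (input) straight :: "(nat \<times> nat) set" where
  "straight \<equiv> {(1, 1), (2, 2)}"

abbreviation (input) crossed :: "(nat \<times> nat) set" where
  "crossed \<equiv> {(1, 2), (2, 1)}"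

lemma perfect_matching_2: "perfect_matching 2 \<mu> \<longleftrightarrow> \<mu> = straight \<or> \<mu> = crossed"
proof
  assume "perfect_matching 2 \<mu>"
  then have "\<mu> \<subseteq> {1, 2} \<times> {1, 2}"
    and ex: "\<exists>!w. (1, w) \<in> \<mu>" "\<exists>!w. (2, w) \<in> \<mu>" "\<exists>!m. (m, 1) \<in> \<mu>"
    by (simp_all add: perfect_matching_def)
  then have sub: "\<mu> \<subseteq> {(1, 1), (1, 2), (2, 1), (2, 2)}" by blast
  have num_neq: "1 \<noteq> (2 :: nat)" by simp
  have one_of_two: "P 1 \<longleftrightarrow> \<not> P 2" if "\<exists>!x. P x" "\<And>x. P x \<Longrightarrow> x = 1 \<or> x = 2" for P :: "nat \<Rightarrow> bool"
    using that by (metis num_neq)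
  have "(1, 1) \<in> \<mu> \<longleftrightarrow> (1, 2) \<notin> \<mu>"
    by (rule one_of_two[OF ex(1)]) (drule subsetD[OF sub], simp)
  moreover have "(2, 1) \<in> \<mu> \<longleftrightarrow> (2, 2) \<notin> \<mu>"
    by (rule one_of_two[OF ex(2)]) (drule subsetD[OF sub], simp)
  moreover have "(1, 1) \<in> \<mu> \<longleftrightarrow> (2, 1) \<notin> \<mu>"
    by (rule one_of_two[OF ex(3)]) (drule subsetD[OF sub], simp)
  ultimately have "\<mu> \<inter> {(1, 1), (1, 2), (2, 1), (2, 2)} = straight \<or>
      \<mu> \<inter> {(1, 1), (1, 2), (2, 1), (2, 2)} = crossed"
    by (cases "(1, 1) \<in> \<mu>") simp_all
  then show "\<mu> = straight \<or> \<mu> = crossed"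
    unfolding Int_absorb2[OF sub] .
qed (elim disjE; simp add: perfect_matching_def)

text \<open>
  The couples of one matching are the only candidates for blocking the other, and such a couple blocks
  when both of its members put each other first.
\<close>

lemma stable_matchings_of_bits:
  "stable_matchings 2 (profile_of_bits (a, b, c, d)) =
     (if \<not> (\<not> a \<and> d \<or> b \<and> \<not> c) then {straight} else {}) \<union>
     (if \<not> (a \<and> c \<or> \<not> b \<and> \<not> d) then {crossed} else {})"
proof -
  let ?p = "profile_of_bits (a, b, c, d)"
  have sep: "{x \<in> {s, t}. P x} = (if P s then {s} else {}) \<union> (if P t then {t} else {})"
    for P and s t :: "(nat \<times> nat) set"
    by auto
  have stable: "stable_matchings 2 ?p = {\<mu> \<in> {straight, crossed}.
      \<not> (\<exists>m\<in>{1, 2}. \<exists>w\<in>{1, 2}. blocking_pair ?p \<mu> m w)}"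
    unfolding stable_matchings_def perfect_matching_2 atLeastAtMost_1_2
    by (simp only: insert_iff empty_iff simp_thms)
  have straight: "(\<exists>m\<in>{1, 2}. \<exists>w\<in>{1, 2}. blocking_pair ?p straight m w) \<longleftrightarrow> \<not> a \<and> d \<or> b \<and> \<not> c"
    by (simp add: blocking_pair_def man_prefers_def woman_prefers_def)
  have crossed: "(\<exists>m\<in>{1, 2}. \<exists>w\<in>{1, 2}. blocking_pair ?p crossed m w) \<longleftrightarrow> a \<and> c \<or> \<not> b \<and> \<not> d"
    by (simp add: blocking_pair_def man_prefers_def woman_prefers_def)
  show ?thesis
    unfolding stable sep straight crossed by (rule refl)
qed

lemma egalitarian_cost_eq: "egalitarian_cost p w m = woman_rank p w m + man_rank p m w"
  by (simp add: egalitarian_cost_def mutual_ranking_def)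

lemma crossed_neq_straight: "crossed \<noteq> straight"
proof
  assume eq: "crossed = straight"
  have "(1, 2) \<in> crossed" by simp
  then show False unfolding eq by simp
qed

section \<open>Properties of each type\<close>

lemmas stability_and_cost = stable_matchings_of_bits total_cost_def egalitarian_cost_eq

text \<open>
  If the men agree, the rank that a woman receives identifies her, and then the rank that she gives
  identifies the man; if the women agree, the same holds with the roles exchanged.
\<close>

lemma disjoint_profile_2I:
  assumes p: "p = profile_of_bits (a, b, c, d)" and agree: "a = b \<or> c = d"
  shows "disjoint_profile 2 p"
proof -
  have unique_pair: "(\<exists>!(x, y). (x, y) \<in> A \<times> B \<and> P x y) \<longleftrightarrow>
      (\<exists>x\<in>A. \<exists>y\<in>B. P x y \<and> (\<forall>x'\<in>A. \<forall>y'\<in>B. P x' y' \<longrightarrow> x' = x \<and> y' = y))"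
    for A B :: "nat set" and P
    by (simp add: Ex1_def) blast
  show ?thesis
    using agree unfolding disjoint_profile_def unique_pair p atLeastAtMost_1_2 mutual_ranking_def
    by (cases a; cases b; cases c; cases d) simp_all
qed

lemma mirror_imp_joint: "mirror_profile n p \<Longrightarrow> joint_profile n p"
  by (auto simp: mirror_profile_def joint_profile_def)

text \<open>The constant sum of the two ranks makes either one a function of the other.\<close>

lemma pseudo_Latin_imp_joint:
  assumes "pseudo_Latin_profile n p"
  shows "joint_profile n p"
  unfolding joint_profile_def joint_via_def
proof (intro exI ballI impI)
  fix m w i assume "m \<in> {1..n}" "w \<in> {1..n}" "woman_rank p w m = i"
  moreover from this have "egalitarian_cost p w m = n + 1"
    using assms unfolding pseudo_Latin_profile_def by blast
  ultimately show "man_rank p m w = n + 1 - i"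
    by (simp add: egalitarian_cost_eq)
qed

lemma type_A_properties:
  assumes "p \<in> profiles_of_type TypeA"
  shows "disjoint_profile 2 p \<and> card (stable_matchings 2 p) = 1
    \<and> (\<forall>\<mu>\<in>stable_matchings 2 p. total_cost p \<mu> = 6)"
proof -
  obtain a b c d where p: "p = profile_of_bits (a, b, c, d)"
    and type: "type_of_bits (a, b, c, d) = TypeA"
    using assms by (auto simp: profiles_of_type_eq)
  have "b = a" "d = c"
    using type by (auto simp: type_of_bits_def split: if_splits)
  then show ?thesis
    using disjoint_profile_2I[OF p] unfolding p
    by (cases a; cases c) (simp_all add: stability_and_cost)
qed

lemma type_B_properties:
  assumes "p \<in> profiles_of_type TypeB"
  shows "disjoint_profile 2 p \<and> card (stable_matchings 2 p) = 1
    \<and> (\<forall>\<mu>\<in>stable_matchings 2 p. total_cost p \<mu> = 5)"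
proof -
  obtain a b c d where p: "p = profile_of_bits (a, b, c, d)"
    and type: "type_of_bits (a, b, c, d) = TypeB"
    using assms by (auto simp: profiles_of_type_eq)
  have "b = a \<and> d = (\<not> c) \<or> b = (\<not> a) \<and> d = c"
    using type by (auto simp: type_of_bits_def split: if_splits)
  then show ?thesis
    using disjoint_profile_2I[OF p] unfolding p
    by (cases a; cases c; elim disjE conjE) (simp_all add: stability_and_cost)
qed

lemma type_C_properties:
  assumes "p \<in> profiles_of_type TypeC"
  shows "joint_profile 2 p \<and> mirror_profile 2 p \<and> card (stable_matchings 2 p) = 1
    \<and> (\<forall>\<mu>\<in>stable_matchings 2 p. total_cost p \<mu> = 4)"
proof -
  obtain a b c d where p: "p = profile_of_bits (a, b, c, d)"
    and type: "type_of_bits (a, b, c, d) = TypeC"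
    using assms by (auto simp: profiles_of_type_eq)
  have bits: "b = (\<not> a)" "c = a" "d = (\<not> a)"
    using type by (auto simp: type_of_bits_def split: if_splits)
  have "joint_via 2 id p"
    unfolding joint_via_def p bits atLeastAtMost_1_2 by (cases a) simp_all
  then have "mirror_profile 2 p"
    unfolding mirror_profile_def by auto
  moreover have "card (stable_matchings 2 p) = 1
      \<and> (\<forall>\<mu>\<in>stable_matchings 2 p. total_cost p \<mu> = 4)"
    unfolding p bits by (cases a) (simp_all add: stability_and_cost)
  ultimately show ?thesis
    by (simp add: mirror_imp_joint)
qed

lemma type_D_properties:
  assumes "p \<in> profiles_of_type TypeD"
  shows "joint_profile 2 p \<and> pseudo_Latin_profile 2 p \<and> card (stable_matchings 2 p) = 2
    \<and> (\<forall>\<mu>\<in>stable_matchings 2 p. total_cost p \<mu> = 6)"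
proof -
  obtain a b c d where p: "p = profile_of_bits (a, b, c, d)"
    and type: "type_of_bits (a, b, c, d) = TypeD"
    using assms by (auto simp: profiles_of_type_eq)
  have bits: "b = (\<not> a)" "c = (\<not> a)" "d = a"
    using type by (auto simp: type_of_bits_def split: if_splits)
  have "pseudo_Latin_profile 2 p"
    unfolding pseudo_Latin_profile_def p bits atLeastAtMost_1_2
    by (cases a) (simp_all add: egalitarian_cost_eq)
  moreover have "card (stable_matchings 2 p) = 2
      \<and> (\<forall>\<mu>\<in>stable_matchings 2 p. total_cost p \<mu> = 6)"
    unfolding p bits using crossed_neq_straight
    by (cases a) (simp_all add: stability_and_cost)
  ultimately show ?thesis
    by (simp add: pseudo_Latin_imp_joint)
qed

theorem mainTheorem5:
  shows "card (profiles 2) = 16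
    \<and> (\<forall>p\<in>profiles 2. \<exists>!t. of_type t p)
    \<and> (card (profiles_of_type TypeA) = 4
       \<and> (\<forall>p\<in>profiles_of_type TypeA. disjoint_profile 2 p
            \<and> card (stable_matchings 2 p) = 1
            \<and> (\<forall>\<mu>\<in>stable_matchings 2 p. total_cost p \<mu> = 6)))
    \<and> (card (profiles_of_type TypeB) = 8
       \<and> (\<forall>p\<in>profiles_of_type TypeB. disjoint_profile 2 p
            \<and> card (stable_matchings 2 p) = 1
            \<and> (\<forall>\<mu>\<in>stable_matchings 2 p. total_cost p \<mu> = 5)))
    \<and> (card (profiles_of_type TypeC) = 2
       \<and> (\<forall>p\<in>profiles_of_type TypeC. joint_profile 2 p \<and> mirror_profile 2 p
            \<and> card (stable_matchings 2 p) = 1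
            \<and> (\<forall>\<mu>\<in>stable_matchings 2 p. total_cost p \<mu> = 4)))
    \<and> (card (profiles_of_type TypeD) = 2
       \<and> (\<forall>p\<in>profiles_of_type TypeD. joint_profile 2 p \<and> pseudo_Latin_profile 2 p
            \<and> card (stable_matchings 2 p) = 2
            \<and> (\<forall>\<mu>\<in>stable_matchings 2 p. total_cost p \<mu> = 6)))"
proof -
  have "card (UNIV :: (bool \<times> bool \<times> bool \<times> bool) set) = 16"
    by (simp add: card_UNIV_bool flip: UNIV_Times_UNIV)
  then have "card (profiles 2) = 16"
    by (simp add: profiles_2 card_profile_of_bits)
  moreover have "\<forall>p\<in>profiles 2. \<exists>!t. of_type t p"
    by (auto simp: profiles_2 of_type_iff)
  ultimately show ?thesis
    by (simp add: card_profiles_of_type type_A_properties type_B_properties type_C_properties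
        type_D_properties)
qed

end
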